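(* Let $\triangle ABC$ be an equilateral triangle of area $1$ with base $BC$, and consider layered configurations in $\triangle ABC$ with $n$ triangles per layer, $k$ shaded triangles per layer ($1\le k<n$), and ratio $s\in(0,1)$ of consecutive parallel segments, as defined in the context. Mabry's and Edgar's configurations are the only ones satisfying (P1), (P2) and (P3). That is: (i) if a configuration satisfies (P1), (P2) and (P3), then $(n,k,s)=(3,1,1/2)$ or $(n,k,s)=(5,4,2/3)$; and (ii) Mabry's configuration, which has $(n,k,s)=(3,1,1/2)$, and Edgar's configuration, which has $(n,k,s)=(5,4,2/3)$, both satisfy (P1), (P2) and (P3).
   Context: A configuration consists of an infinite sequence of line segments $L_0=BC, L_1, L_2,\dots$, all parallel to $BC$, each $L_j$ having its endpoints on the sides $AB$ and $AC$, with $L_{j+1}$ strictly closer to $A$ than $L_j$; for $j\ge 1$ the $j$-th layer is the trapezoid bounded by $L_{j-1}$, $L_j$ and the sides $AB$, $AC$. Each layer is partitioned into triangles (triangles with disjoint interiors whose union is the layer), some of which are shaded. The properties are: (P1) The layers partition $\triangle ABC$ (up to the vertex $A$ and shared boundaries). Every layer is partitioned into the same number $n$ of congruent equilateral triangles, and the same number $k$ of these are shaded in every layer, where $1\le k<n$. The height of the triangles in a layer equals the height of that layer (the distance between the two parallel segments bounding it). (P2) The lengths of $L_0,L_1,L_2,\dots$ form a geometric progression, with ratio $s\in(0,1)$, i.e. $|L_{j+1}|=s|L_j|$ for all $j\ge 0$. (P3) The geometric series $ku+kus^2+kus^4+\cdots$ obtained by adding up, layer by layer, the shaded area, where $u=(1-s^2)/n$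 is the area of each triangle in the first layer, has first term equal to its common ratio (i.e. $ku=s^2$). Mabry's configuration: $s=1/2$; each layer is divided into $3$ equilateral triangles (two with a side on the lower segment of the layer, and one between them with a side on the upper segment), and only the middle one is shaded. It illustrates $\frac14+\left(\frac14\right)^2+\left(\frac14\right)^3+\cdots=\frac13$. Edgar's configuration: $s=2/3$; each layer is divided into $5$ equilateral triangles (three with a side on the lower segment of the layer, alternating with two with a side on the upper segment), and all except the middle one are shaded. It illustrates $\frac49+\left(\frac49\right)^2+\left(\frac49\right)^3+\cdots=\frac45$. Configurations are identified by their parameters $(n,k,s)$; which $k$ of the $n$ triangles in a layer are shaded is immaterial. *)

theory Defs
  imports "HOL-Analysis.Analysis"
begin

abbreviation area :: "(real^2) set \<Rightarrow> real" where
  "area X \<equiv> measure lebesgue X"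

definition equilateral :: "real^2 \<Rightarrow> real^2 \<Rightarrow> real^2 \<Rightarrow> bool" where
  "equilateral a b c \<longleftrightarrow> a \<noteq> b \<and> dist a b = dist b c \<and> dist b c = dist c a"

definition altitude :: "real^2 \<Rightarrow> real^2 \<Rightarrow> real^2 \<Rightarrow> real" where
  "altitude a b c = infdist a (affine hull {b, c})"

definition is_triangle :: "(real^2) set \<Rightarrow> bool" where
  "is_triangle t \<longleftrightarrow> (\<exists>a b c. \<not> collinear {a, b, c} \<and> t = convex hull {a, b, c})"

definition congruent_figures :: "(real^2) set \<Rightarrow> (real^2) set \<Rightarrow> bool" where
  "congruent_figures X Y \<longleftrightarrow>
     (\<exists>f :: real^2 \<Rightarrow> real^2. (\<forall>x y. dist (f x) (f y) = dist x y) \<and> f ` X = Y)"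

definition disjoint_interiors :: "(real^2) set \<Rightarrow> (real^2) set \<Rightarrow> bool" where
  "disjoint_interiors X Y \<longleftrightarrow> interior X \<inter> interior Y = {}"

text \<open>
  Layers are counted from 0: layer \<open>j\<close> lies between the segments \<open>L\<^sub>j\<close> and \<open>L\<^sub>j\<^sub>+\<^sub>1\<close>,
  and \<open>tiles j\<close>, \<open>shaded j\<close> are the triangles of that layer, as point sets.
  \<open>left_end j\<close> and \<open>right_end j\<close> are the endpoints of \<open>L\<^sub>j\<close> on \<open>AB\<close> and \<open>AC\<close>.
\<close>

record layering =
  left_end :: "nat \<Rightarrow> real^2"
  right_end :: "nat \<Rightarrow> real^2"
  tiles :: "nat \<Rightarrow> (real^2) set set"
  shaded :: "nat \<Rightarrow> (real^2) set set"

definition seg :: "layering \<Rightarrow> nat \<Rightarrow> (real^2) set" where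
  "seg L j = closed_segment (left_end L j) (right_end L j)"

definition layer :: "layering \<Rightarrow> nat \<Rightarrow> (real^2) set" where
  "layer L j = convex hull {left_end L j, right_end L j, left_end L (Suc j), right_end L (Suc j)}"

definition shaded_area :: "layering \<Rightarrow> nat \<Rightarrow> real" where
  "shaded_area L j = area (\<Union>(shaded L j))"

definition configuration :: "real^2 \<Rightarrow> real^2 \<Rightarrow> real^2 \<Rightarrow> layering \<Rightarrow> bool" where
  "configuration A B C L \<longleftrightarrow>
     left_end L 0 = B \<and> right_end L 0 = C \<and>
     (\<forall>j. left_end L j \<in> closed_segment A B \<and> right_end L j \<in> closed_segment A C \<and>
          (\<exists>c. c \<noteq> 0 \<and> right_end L j - left_end L j = c *\<^sub>R (C - B)) \<and>
          infdist A (seg L (Suc j)) < infdist A (seg L j)) \<and>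
     (\<forall>j. finite (tiles L j) \<and> (\<forall>t\<in>tiles L j. is_triangle t) \<and>
          pairwise disjoint_interiors (tiles L j) \<and> \<Union>(tiles L j) = layer L j \<and>
          shaded L j \<subseteq> tiles L j)"

definition P1 :: "real^2 \<Rightarrow> real^2 \<Rightarrow> real^2 \<Rightarrow> layering \<Rightarrow> nat \<Rightarrow> nat \<Rightarrow> bool" where
  "P1 A B C L n k \<longleftrightarrow>
     (\<Union>j. layer L j) = convex hull {A, B, C} - {A} \<and>
     (\<forall>i j. i \<noteq> j \<longrightarrow> disjoint_interiors (layer L i) (layer L j)) \<and>
     1 \<le> k \<and> k < n \<and>
     (\<forall>j. card (tiles L j) = n \<and> card (shaded L j) = k \<and>
          (\<forall>t\<in>tiles L j. \<forall>t'\<in>tiles L j. congruent_figures t t') \<and>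
          (\<forall>t\<in>tiles L j. \<exists>a b c. t = convex hull {a, b, c} \<and> equilateral a b c \<and>
             altitude a b c = setdist (seg L j) (seg L (Suc j))))"

definition P2 :: "layering \<Rightarrow> real \<Rightarrow> bool" where
  "P2 L s \<longleftrightarrow> 0 < s \<and> s < 1 \<and>
     (\<forall>j. dist (left_end L (Suc j)) (right_end L (Suc j)) =
          s * dist (left_end L j) (right_end L j))"

text \<open>
  In \<open>P3\<close>, \<open>u\<close> is the actual area of every triangle of the first layer. Its value
  \<open>(1 - s\<^sup>2) / n\<close> is not put into the definition: it follows from \<open>P1\<close> and \<open>P2\<close> when the
  triangle \<open>ABC\<close> has area 1. The series of shaded areas is \<open>k u + k u s\<^sup>2 + k u s\<^sup>4 + \<dots>\<close>, and the
  last conjunct equates its first term with its common ratio.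
\<close>

definition P3 :: "layering \<Rightarrow> nat \<Rightarrow> real \<Rightarrow> bool" where
  "P3 L k s \<longleftrightarrow>
     (\<exists>u. (\<forall>t\<in>tiles L 0. area t = u) \<and>
          (\<forall>j. shaded_area L j = real k * u * (s^2) ^ j) \<and>
          real k * u = s^2)"

definition div_point :: "nat \<Rightarrow> real^2 \<Rightarrow> real^2 \<Rightarrow> nat \<Rightarrow> real^2" where
  "div_point m p q i = p + (real i / real m) *\<^sub>R (q - p)"

text \<open>
  The lower segment \<open>pq\<close> of a layer is cut into \<open>m\<close> equal parts and the upper segment \<open>p'q'\<close>
  into \<open>m - 1\<close>. From left to right, the layer then consists of the triangles
  \<open>up_tile 0\<close>, \<open>down_tile 0\<close>, \<open>up_tile 1\<close>, \<dots>, \<open>down_tile (m - 2)\<close>, \<open>up_tile (m - 1)\<close>, where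
  up tiles have a side on the lower segment and down tiles one on the upper segment.
\<close>

definition up_tile ::
  "nat \<Rightarrow> real^2 \<Rightarrow> real^2 \<Rightarrow> real^2 \<Rightarrow> real^2 \<Rightarrow> nat \<Rightarrow> (real^2) set" where
  "up_tile m p q p' q' i =
     convex hull {div_point m p q i, div_point m p q (i + 1), div_point (m - 1) p' q' i}"

definition down_tile ::
  "nat \<Rightarrow> real^2 \<Rightarrow> real^2 \<Rightarrow> real^2 \<Rightarrow> real^2 \<Rightarrow> nat \<Rightarrow> (real^2) set" where
  "down_tile m p q p' q' i =
     convex hull {div_point (m - 1) p' q' i, div_point (m - 1) p' q' (i + 1),
                  div_point m p q (i + 1)}"

definition side_point :: "real^2 \<Rightarrow> real^2 \<Rightarrow> real \<Rightarrow> nat \<Rightarrow> real^2" where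
  "side_point A X s j = A + s ^ j *\<^sub>R (X - A)"

definition mabry :: "real^2 \<Rightarrow> real^2 \<Rightarrow> real^2 \<Rightarrow> layering" where
  "mabry A B C =
     (let p = side_point A B (1/2); q = side_point A C (1/2);
          up = (\<lambda>j. up_tile 2 (p j) (q j) (p (Suc j)) (q (Suc j)));
          down = (\<lambda>j. down_tile 2 (p j) (q j) (p (Suc j)) (q (Suc j)))
      in \<lparr>left_end = p, right_end = q,
          tiles = (\<lambda>j. {up j 0, down j 0, up j 1}),
          shaded = (\<lambda>j. {down j 0})\<rparr>)"

definition edgar :: "real^2 \<Rightarrow> real^2 \<Rightarrow> real^2 \<Rightarrow> layering" where
  "edgar A B C =
     (let p = side_point A B (2/3); q = side_point A C (2/3);
          up = (\<lambda>j. up_tile 3 (p j) (q j) (p (Suc j)) (q (Suc j)));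
          down = (\<lambda>j. down_tile 3 (p j) (q j) (p (Suc j)) (q (Suc j)))
      in \<lparr>left_end = p, right_end = q,
          tiles = (\<lambda>j. {up j 0, down j 0, up j 1, down j 1, up j 2}),
          shaded = (\<lambda>j. {up j 0, down j 0, down j 1, up j 2})\<rparr>)"

end

theory Submission
  imports Defs
begin

text \<open>
  Necessity needs only two areas in the first layer. The layer has
  height \<open>1 - s\<close> times the altitude of \<open>ABC\<close>, so each tile, being equilateral of that
  altitude, has area \<open>(1 - s)\<^sup>2\<close>; the layer is the triangle minus a copy scaled by \<open>s\<close>, so it has area
  \<open>1 - s\<^sup>2\<close>. Hence \<open>n (1 - s)\<^sup>2 = 1 - s\<^sup>2\<close>, while \<open>P3\<close> says \<open>k (1 - s)\<^sup>2 = s\<^sup>2\<close> (\<open>area_count\<close>). The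
  first equation gives \<open>n = (1 + s) / (1 - s)\<close>, and the second then gives \<open>4 k = (n - 1)\<^sup>2\<close>. So \<open>n\<close>
  is odd, and \<open>k < n\<close> leaves only \<open>n \<le> 5\<close> (\<open>solve_counts\<close>).

  For existence, both configurations are instances of one construction with \<open>s = (m - 1) / m\<close>, for
  \<open>m = 2\<close> and \<open>m = 3\<close>. In affine coordinates along \<open>AB\<close> and \<open>AC\<close>, every layer is the strip
  \<open>(m - 1) d \<le> \<alpha> + \<beta> \<le> m d\<close> of the positive quadrant, where \<open>d\<close> is \<open>s\<^sup>j / m\<close>, and its tiles are
  the cells of the triangular lattice of mesh \<open>d\<close>. Each cell is an upright or inverted homothetic copy
  of \<open>ABC\<close>, which yields its shape, altitude, area and congruence class at once (lemmas about
  \<open>copy\<close>), and both covering and disjointness become inequalities between coordinates (\<open>Union_tiles\<close>,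
  \<open>pairwise_tiles\<close>). A layer has \<open>2 m - 1\<close> tiles, and \<open>P3\<close> holds when \<open>(m - 1)\<^sup>2\<close> of them are shaded:
  \<open>1\<close> of \<open>3\<close>, or \<open>4\<close> of \<open>5\<close>.
\<close>

section \<open>Interiors and areas of convex sets\<close>

lemma disjoint_interiors_halfspaces:
  assumes "w \<noteq> 0" "X \<subseteq> {x. w \<bullet> x \<le> c}" "Y \<subseteq> {x. w \<bullet> x \<ge> c}"
  shows "disjoint_interiors X Y"
  using interior_mono[OF assms(2)] interior_mono[OF assms(3)] assms(1)
  by (fastforce simp: disjoint_interiors_def)

text \<open>
  A common point of \<open>X\<close> and \<open>Y\<close> lies on one of the two frontiers, and the frontier of a convex
  set is negligible.
\<close>

lemma negligible_Int_of_disjoint_interiors: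
  assumes "convex X" "convex Y" "disjoint_interiors X Y"
  shows "negligible (X \<inter> Y)"
proof -
  have "X \<inter> Y \<subseteq> frontier X \<union> frontier Y"
    using assms(3) closure_subset by (auto simp: frontier_def disjoint_interiors_def)
  thus ?thesis
    using assms(1,2) by (metis negligible_Un negligible_convex_frontier negligible_subset)
qed

lemma area_Union:
  assumes "finite F" "\<And>X. X \<in> F \<Longrightarrow> compact X \<and> convex X" "pairwise disjoint_interiors F"
  shows "area (\<Union>F) = (\<Sum>X\<in>F. area X)"
proof (rule measure_negligible_finite_Union)
  show "pairwise (\<lambda>S T. negligible (S \<inter> T)) F"
    using assms by (auto simp: pairwise_def intro!: negligible_Int_of_disjoint_interiors)
qed (use assms in \<open>auto simp: lmeasurable_compact\<close>)

section \<open>Coordinates in an equilateral triangle\<close>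

locale equilateral_triangle =
  fixes A B C :: "real^2"
  assumes equi: "equilateral A B C"
begin

definition side :: real where "side = dist A B"

definition height :: real where "height = sqrt 3 / 2 * side"

text \<open>
  The coordinates are affine: \<open>A\<close> is the origin, the axes are the lines \<open>AB\<close> and \<open>AC\<close>, and
  \<open>\<alpha> + \<beta>\<close> is constant exactly on the lines parallel to \<open>BC\<close>.
\<close>

definition pt :: "real \<Rightarrow> real \<Rightarrow> real^2" where
  "pt \<alpha> \<beta> = A + \<alpha> *\<^sub>R (B - A) + \<beta> *\<^sub>R (C - A)"

lemma pt_vertices [simp]: "pt 0 0 = A" "pt 1 0 = B" "pt 0 1 = C"
  by (simp_all add: pt_def)

lemma side_pos: "side > 0"
  using equi unfolding side_def equilateral_def by (metis zero_less_dist_iff)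

lemma height_pos: "height > 0"
  using side_pos by (simp add: height_def)

lemma dist_vertices: "dist A B = side" "dist A C = side" "dist B C = side"
  using equi by (auto simp: side_def equilateral_def dist_commute)

lemma inner_edges:
  "(B - A) \<bullet> (B - A) = side\<^sup>2" "(C - A) \<bullet> (C - A) = side\<^sup>2"
  "(B - A) \<bullet> (C - A) = side\<^sup>2 / 2" "(C - A) \<bullet> (B - A) = side\<^sup>2 / 2"
proof -
  have n: "norm (B - A) = side" "norm (C - A) = side" "norm ((B - A) - (C - A)) = side"
    using dist_vertices by (auto simp: dist_norm norm_minus_commute)
  show 1: "(B - A) \<bullet> (B - A) = side\<^sup>2" "(C - A) \<bullet> (C - A) = side\<^sup>2"
    using n by (simp_all flip: power2_norm_eq_inner)
  show "(B - A) \<bullet> (C - A) = side\<^sup>2 / 2"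
    unfolding dot_norm_neg n by simp
  thus "(C - A) \<bullet> (B - A) = side\<^sup>2 / 2"
    by (simp add: inner_commute)
qed

lemma pt_convex_comb:
  assumes "u + v = 1"
  shows "u *\<^sub>R pt \<alpha> \<beta> + v *\<^sub>R pt \<alpha>' \<beta>' = pt (u * \<alpha> + v * \<alpha>') (u * \<beta> + v * \<beta>')"
proof -
  have "u *\<^sub>R A + v *\<^sub>R A = A"
    using assms by (metis scaleR_add_left scaleR_one)
  thus ?thesis
    by (simp add: pt_def algebra_simps)
qed

text \<open>
  Since \<open>B - A\<close> and \<open>C - A\<close> are linearly independent, any affine function of the coordinates is
  given by an inner product. This makes coordinates unique, and it turns lines in coordinates into
  hyperplanes, which separate interiors.
\<close>

lemma coordinate_functional:
  assumes "(p, q) \<noteq> (0, 0)"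
  obtains w where "w \<noteq> 0" "\<And>\<alpha> \<beta>. w \<bullet> pt \<alpha> \<beta> = w \<bullet> A + p * \<alpha> + q * \<beta>"
proof -
  \<comment> \<open>The Gram matrix of the two edges is \<open>side\<^sup>2\<close> times \<open>(1, 1/2; 1/2, 1)\<close>; the coefficients of \<open>w\<close>
    come from its inverse.\<close>
  define w where
    "w = (4 / (3 * side\<^sup>2)) *\<^sub>R ((p - q/2) *\<^sub>R (B - A) + (q - p/2) *\<^sub>R (C - A))"
  have w: "w \<bullet> (B - A) = p" "w \<bullet> (C - A) = q"
    unfolding w_def inner_scaleR_left inner_add_left inner_edges
    using side_pos by (simp_all add: field_simps)
  have "w \<noteq> 0"
    using w assms by auto
  moreover have "w \<bullet> pt \<alpha> \<beta> = w \<bullet> A + p * \<alpha> + q * \<beta>" for \<alpha> \<beta>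
    using w by (simp add: pt_def inner_add_right)
  ultimately show ?thesis
    using that by blast
qed

lemma pt_eq_iff [simp]: "pt \<alpha> \<beta> = pt \<alpha>' \<beta>' \<longleftrightarrow> \<alpha> = \<alpha>' \<and> \<beta> = \<beta>'"
proof
  assume eq: "pt \<alpha> \<beta> = pt \<alpha>' \<beta>'"
  obtain w1 where "\<And>\<alpha> \<beta>. w1 \<bullet> pt \<alpha> \<beta> = w1 \<bullet> A + 1 * \<alpha> + 0 * \<beta>"
    by (rule coordinate_functional[of 1 0]) auto
  moreover obtain w2 where "\<And>\<alpha> \<beta>. w2 \<bullet> pt \<alpha> \<beta> = w2 \<bullet> A + 0 * \<alpha> + 1 * \<beta>"
    by (rule coordinate_functional[of 0 1]) auto
  ultimately show "\<alpha> = \<alpha>' \<and> \<beta> = \<beta>'"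
    using arg_cong[OF eq, of "\<lambda>x. w1 \<bullet> x"] arg_cong[OF eq, of "\<lambda>x. w2 \<bullet> x"] by simp
qed auto

lemma disjoint_interiors_by_line:
  assumes "(p, q) \<noteq> (0, 0)"
    and "X \<subseteq> {pt \<alpha> \<beta> |\<alpha> \<beta>. p * \<alpha> + q * \<beta> \<le> c}"
    and "Y \<subseteq> {pt \<alpha> \<beta> |\<alpha> \<beta>. p * \<alpha> + q * \<beta> \<ge> c}"
  shows "disjoint_interiors X Y"
proof -
  obtain w where "w \<noteq> 0" and w: "\<And>\<alpha> \<beta>. w \<bullet> pt \<alpha> \<beta> = w \<bullet> A + p * \<alpha> + q * \<beta>"
    using coordinate_functional[OF assms(1)] by blast
  show ?thesis
  proof (rule disjoint_interiors_halfspaces)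
    show "w \<noteq> 0" by fact
    show "X \<subseteq> {x. w \<bullet> x \<le> w \<bullet> A + c}"
      using assms(2) by (fastforce simp: w)
    show "Y \<subseteq> {x. w \<bullet> x \<ge> w \<bullet> A + c}"
      using assms(3) by (fastforce simp: w)
  qed
qed

text \<open>
  Collinearity would make Cauchy-Schwarz an equality for the two edges at \<open>A\<close>, but their inner
  product is half the product of their lengths.
\<close>

lemma not_collinear: "\<not> collinear {A, B, C}"
proof
  assume "collinear {A, B, C}"
  hence "collinear {0, B - A, C - A}"
    by (subst (asm) insert_commute) (simp add: collinear_3)
  hence "\<bar>(B - A) \<bullet> (C - A)\<bar> = norm (B - A) * norm (C - A)"
    by (simp add: norm_cauchy_schwarz_equal)
  also have "\<dots> = side * side"
    using dist_vertices by (simp add: dist_norm norm_minus_commute)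
  finally show False
    using side_pos by (simp add: inner_edges power2_eq_square)
qed

lemma area_eq: "area (convex hull {A, B, C}) = sqrt 3 / 4 * side\<^sup>2"
proof -
  have "area (convex hull {A, B, C}) = measure lborel (convex hull {A, B, C})"
    by (simp add: borel_compact finite_imp_compact_convex_hull)
  also have "\<dots> = sqrt (3 * (side\<^sup>2 / 4)\<^sup>2)"
    unfolding heron dist_vertices by (simp add: field_simps power2_eq_square)
  also have "\<dots> = sqrt 3 / 4 * side\<^sup>2"
    by (simp add: real_sqrt_mult)
  finally show ?thesis .
qed

text \<open>
  The median from \<open>A\<close> is perpendicular to \<open>BC\<close>, so projecting to it bounds the distance of two
  points on lines parallel to \<open>BC\<close> from below, and the points on the median itself attain the bound.
  The sets may be segments, whole lines or \<open>{A}\<close>, so the lemma covers the gap between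
  consecutive segments, the altitude, and the distance of a segment from \<open>A\<close>.
\<close>

lemma setdist_levels:
  assumes "S \<subseteq> {pt \<alpha> \<beta> |\<alpha> \<beta>. \<alpha> + \<beta> = r}" "pt (r/2) (r/2) \<in> S"
    and "T \<subseteq> {pt \<alpha> \<beta> |\<alpha> \<beta>. \<alpha> + \<beta> = t}" "pt (t/2) (t/2) \<in> T"
  shows "setdist S T = \<bar>r - t\<bar> * height"
proof -
  define w where "w = (1/2) *\<^sub>R ((B - A) + (C - A))"
  have "w \<bullet> w = 3 / 4 * side\<^sup>2"
    unfolding w_def inner_scaleR_left inner_scaleR_right inner_add_left inner_add_right inner_edges
    by simp
  also have "\<dots> = height\<^sup>2"
    by (simp add: height_def power_mult_distrib power_divide)
  finally have norm_w: "norm w = height"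
    using height_pos by (simp add: norm_eq_sqrt_inner)
  have wB: "w \<bullet> (B - A) = height\<^sup>2" "w \<bullet> (C - A) = height\<^sup>2"
    unfolding w_def inner_scaleR_left inner_add_left inner_edges
    by (simp_all add: height_def power_mult_distrib power_divide)
  have "pt (x/2) (x/2) = A + x *\<^sub>R w" for x
    unfolding pt_def w_def scaleR_scaleR by (simp only: scaleR_add_right add.assoc times_divide_eq_right mult_1_right)
  hence mid: "pt (r/2) (r/2) - pt (t/2) (t/2) = (r - t) *\<^sub>R w"
    by (simp add: scaleR_diff_left)
  have d: "dist (pt (r/2) (r/2)) (pt (t/2) (t/2)) = \<bar>r - t\<bar> * height"
    by (simp add: dist_norm mid norm_w)
  have "setdist S T = dist (pt (r/2) (r/2)) (pt (t/2) (t/2))"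
  proof (rule setdist_unique)
    fix x y assume "x \<in> S \<and> y \<in> T"
    then obtain \<alpha> \<beta> \<alpha>' \<beta>' where x: "x = pt \<alpha> \<beta>" "\<alpha> + \<beta> = r" and y: "y = pt \<alpha>' \<beta>'" "\<alpha>' + \<beta>' = t"
      using assms by blast
    have "w \<bullet> (x - y) = w \<bullet> ((\<alpha> - \<alpha>') *\<^sub>R (B - A) + (\<beta> - \<beta>') *\<^sub>R (C - A))"
      by (simp add: x y pt_def algebra_simps)
    also have "\<dots> = (r - t) * height\<^sup>2"
      unfolding inner_add_right inner_scaleR_right wB
      by (simp flip: x(2) y(2) add: algebra_simps)
    finally have "\<bar>r - t\<bar> * height\<^sup>2 \<le> height * norm (x - y)"
      using Cauchy_Schwarz_ineq2[of w "x - y"] by (simp add: norm_w abs_mult)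
    hence "\<bar>r - t\<bar> * height \<le> norm (x - y)"
      using height_pos by (simp add: power2_eq_square algebra_simps)
    thus "dist (pt (r/2) (r/2)) (pt (t/2) (t/2)) \<le> dist x y"
      unfolding d by (simp add: dist_norm)
  qed (use assms in auto)
  thus ?thesis by (simp add: d)
qed

lemma altitude_eq: "altitude A B C = height"
proof -
  have "setdist {A} (affine hull {B, C}) = \<bar>0 - 1\<bar> * height"
  proof (rule setdist_levels)
    have pt1: "u *\<^sub>R B + v *\<^sub>R C = pt u v" if "u + v = 1" for u v
      using pt_convex_comb[OF that, of 1 0 0 1] by simp
    show "affine hull {B, C} \<subseteq> {pt \<alpha> \<beta> |\<alpha> \<beta>. \<alpha> + \<beta> = 1}"
      using pt1 by (auto simp: affine_hull_2)
    have "(1/2) *\<^sub>R B + (1/2) *\<^sub>R C \<in> affine hull {B, C}"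
      unfolding affine_hull_2 by (auto intro!: exI[of _ "1/2"])
    thus "pt (1 / 2) (1 / 2) \<in> affine hull {B, C}"
      by (simp add: pt1)
    show "{A} \<subseteq> {pt \<alpha> \<beta> |\<alpha> \<beta>. \<alpha> + \<beta> = 0}"
      by (auto intro!: exI[of _ 0])
  qed auto
  thus ?thesis by (simp add: altitude_def infdist_eq_setdist)
qed

lemma setdist_segments:
  "setdist (closed_segment (pt r 0) (pt 0 r)) (closed_segment (pt t 0) (pt 0 t)) =
     \<bar>r - t\<bar> * height"
proof -
  have "closed_segment (pt x 0) (pt 0 x) \<subseteq> {pt \<alpha> \<beta> |\<alpha> \<beta>. \<alpha> + \<beta> = x}" for x
  proof
    fix y assume "y \<in> closed_segment (pt x 0) (pt 0 x)"
    then obtain u where "y = pt ((1 - u) * x) (u * x)"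
      by (auto simp: in_segment pt_convex_comb)
    moreover have "(1 - u) * x + u * x = x"
      by (simp add: algebra_simps)
    ultimately show "y \<in> {pt \<alpha> \<beta> |\<alpha> \<beta>. \<alpha> + \<beta> = x}"
      by blast
  qed
  moreover have "pt (x/2) (x/2) \<in> closed_segment (pt x 0) (pt 0 x)" for x
    unfolding in_segment by (rule exI[of _ "1/2"]) (simp add: pt_convex_comb)
  ultimately show ?thesis by (intro setdist_levels)
qed

section \<open>Trapezoids and homothetic triangles\<close>

definition strip :: "real \<Rightarrow> real \<Rightarrow> (real^2) set" where
  "strip lo hi = {pt \<alpha> \<beta> |\<alpha> \<beta>. 0 \<le> \<alpha> \<and> 0 \<le> \<beta> \<and> lo \<le> \<alpha> + \<beta> \<and> \<alpha> + \<beta> \<le> hi}"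

lemma convex_strip: "convex (strip lo hi)"
proof (rule convexI)
  fix x y and u v :: real
  assume "x \<in> strip lo hi" "y \<in> strip lo hi" and uv: "0 \<le> u" "0 \<le> v" "u + v = 1"
  then obtain \<alpha> \<beta> \<alpha>' \<beta>'
    where x: "x = pt \<alpha> \<beta>" "0 \<le> \<alpha>" "0 \<le> \<beta>" "lo \<le> \<alpha> + \<beta>" "\<alpha> + \<beta> \<le> hi"
      and y: "y = pt \<alpha>' \<beta>'" "0 \<le> \<alpha>'" "0 \<le> \<beta>'" "lo \<le> \<alpha>' + \<beta>'" "\<alpha>' + \<beta>' \<le> hi"
    unfolding strip_def by blast
  have "u * (\<alpha> + \<beta>) + v * (\<alpha>' + \<beta>') \<le> hi"
    using x y uv by (intro convex_bound_le) auto
  moreover have "u * (- \<alpha> - \<beta>) + v * (- \<alpha>' - \<beta>') \<le> - lo"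
    using x y uv by (intro convex_bound_le) auto
  ultimately show "u *\<^sub>R x + v *\<^sub>R y \<in> strip lo hi"
    unfolding strip_def x(1) y(1) pt_convex_comb[OF uv(3)] using x y uv
    by (auto intro!: exI[of _ "u * \<alpha> + v * \<alpha>'"] exI[of _ "u * \<beta> + v * \<beta>'"] simp: algebra_simps)
qed

text \<open>
  For the inclusion of the strip in the hull, a point at level \<open>\<sigma> = \<alpha> + \<beta>\<close> is a convex combination of
  the points of the two sides at that level, and each of these lies between two corners.
\<close>

lemma convex_hull_trapezoid:
  assumes "0 < lo" "lo < hi"
  shows "convex hull {pt hi 0, pt 0 hi, pt lo 0, pt 0 lo} = strip lo hi" (is "?H = _")
proof
  show "?H \<subseteq> strip lo hi"
    by (rule hull_minimal) (use assms in \<open>auto simp: strip_def intro!: convex_strip[unfolded strip_def]\<close>)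
  show "strip lo hi \<subseteq> ?H"
  proof
    fix x assume "x \<in> strip lo hi"
    then obtain \<alpha> \<beta> where x: "x = pt \<alpha> \<beta>" and ab: "0 \<le> \<alpha>" "0 \<le> \<beta>" "lo \<le> \<alpha> + \<beta>" "\<alpha> + \<beta> \<le> hi"
      unfolding strip_def by blast
    define \<sigma> where "\<sigma> = \<alpha> + \<beta>"
    define t where "t = (\<sigma> - lo) / (hi - lo)"
    have t: "0 \<le> t" "t \<le> 1" and \<sigma>: "\<sigma> > 0"
      using ab assms by (auto simp: t_def \<sigma>_def field_simps)
    have "t * (hi - lo) = \<sigma> - lo"
      using assms by (simp add: t_def)
    hence \<sigma>_eq: "t * hi + (1 - t) * lo = \<sigma>"
      by (simp add: algebra_simps)
    have weights: "\<alpha> / \<sigma> + \<beta> / \<sigma> = 1"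
      using \<sigma> by (simp add: \<sigma>_def flip: add_divide_distrib)
    have H: "convex ?H" by simp
    have "t *\<^sub>R pt hi 0 + (1 - t) *\<^sub>R pt lo 0 \<in> ?H" "t *\<^sub>R pt 0 hi + (1 - t) *\<^sub>R pt 0 lo \<in> ?H"
      using t by (auto intro!: convexD[OF H] intro: hull_inc)
    hence ends: "pt \<sigma> 0 \<in> ?H" "pt 0 \<sigma> \<in> ?H"
      by (simp_all add: pt_convex_comb \<sigma>_eq)
    have "(\<alpha> / \<sigma>) *\<^sub>R pt \<sigma> 0 + (\<beta> / \<sigma>) *\<^sub>R pt 0 \<sigma> \<in> ?H"
      using ab \<sigma> weights by (intro convexD[OF H] ends) auto
    thus "x \<in> ?H"
      using \<sigma> by (simp add: pt_convex_comb[OF weights] x)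
  qed
qed

text \<open>
  The image of \<open>ABC\<close> under the homothety of ratio \<open>d\<close> that sends \<open>A\<close> to the point with coordinates
  \<open>a\<close> and \<open>b\<close>. A negative ratio gives the inverted triangles of the grid.
\<close>

definition copy :: "real \<Rightarrow> real \<Rightarrow> real \<Rightarrow> (real^2) set" where
  "copy a b d = convex hull {pt a b, pt (a + d) b, pt a (b + d)}"

lemma copy_eq:
  "copy a b d = {pt (a + u * d) (b + v * d) |u v. 0 \<le> u \<and> 0 \<le> v \<and> u + v \<le> 1}"
proof -
  have "pt a b + u *\<^sub>R (pt (a + d) b - pt a b) + v *\<^sub>R (pt a (b + d) - pt a b) =
        pt (a + u * d) (b + v * d)" for u v
    by (simp add: pt_def algebra_simps)
  thus ?thesis by (simp add: copy_def convex_hull_3_alt)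
qed

lemma copy_upward:
  assumes "d > 0"
  shows "copy a b d = {pt \<alpha> \<beta> |\<alpha> \<beta>. a \<le> \<alpha> \<and> b \<le> \<beta> \<and> \<alpha> + \<beta> \<le> a + b + d}"
    (is "_ = ?R")
proof (intro equalityI subsetI)
  fix x assume "x \<in> copy a b d"
  then obtain u v where x: "x = pt (a + u * d) (b + v * d)" and uv: "0 \<le> u" "0 \<le> v" "u + v \<le> 1"
    unfolding copy_eq by blast
  have "0 \<le> u * d" "0 \<le> v * d" "u * d + v * d \<le> d"
    using uv assms mult_right_mono[OF uv(3), of d] by (simp_all add: algebra_simps)
  thus "x \<in> ?R"
    unfolding x mem_Collect_eq by auto
next
  fix x assume "x \<in> ?R"
  then obtain \<alpha> \<beta> where x: "x = pt \<alpha> \<beta>" "a \<le> \<alpha>" "b \<le> \<beta>" "\<alpha> + \<beta> \<le> a + b + d"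
    by blast
  define u v where "u = (\<alpha> - a) / d" and "v = (\<beta> - b) / d"
  have "x = pt (a + u * d) (b + v * d)" "0 \<le> u" "0 \<le> v"
    using x assms by (simp_all add: u_def v_def)
  moreover have "u + v \<le> 1"
    using x assms by (simp add: u_def v_def flip: add_divide_distrib)
  ultimately show "x \<in> copy a b d"
    unfolding copy_eq by blast
qed

lemma copy_downward:
  assumes "d > 0"
  shows "copy a b (- d) = {pt \<alpha> \<beta> |\<alpha> \<beta>. \<alpha> \<le> a \<and> \<beta> \<le> b \<and> a + b - d \<le> \<alpha> + \<beta>}"
    (is "_ = ?R")
proof (intro equalityI subsetI)
  fix x assume "x \<in> copy a b (- d)"
  then obtain u v where x: "x = pt (a + u * (- d)) (b + v * (- d))" and uv: "0 \<le> u" "0 \<le> v" "u + v \<le> 1"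
    unfolding copy_eq by blast
  have "0 \<le> u * d" "0 \<le> v * d" "u * d + v * d \<le> d"
    using uv assms mult_right_mono[OF uv(3), of d] by (simp_all add: algebra_simps)
  thus "x \<in> ?R"
    unfolding x mem_Collect_eq by auto
next
  fix x assume "x \<in> ?R"
  then obtain \<alpha> \<beta> where x: "x = pt \<alpha> \<beta>" "\<alpha> \<le> a" "\<beta> \<le> b" "a + b - d \<le> \<alpha> + \<beta>"
    by blast
  define u v where "u = (a - \<alpha>) / d" and "v = (b - \<beta>) / d"
  have "x = pt (a + u * (- d)) (b + v * (- d))" "0 \<le> u" "0 \<le> v"
    using x assms by (simp_all add: u_def v_def)
  moreover have "u + v \<le> 1"
    using x assms by (simp add: u_def v_def flip: add_divide_distrib)
  ultimately show "x \<in> copy a b (- d)"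
    unfolding copy_eq by blast
qed

lemma copy_strip:
  assumes "d > 0"
  shows "copy 0 0 d = strip 0 d"
  unfolding copy_upward[OF assms] strip_def by auto

lemma convex_copy: "convex (copy a b d)"
  and compact_copy: "compact (copy a b d)"
  by (auto simp: copy_def intro!: finite_imp_compact_convex_hull)

lemma equilateral_copy:
  assumes "d \<noteq> 0"
  shows "equilateral (pt a b) (pt (a + d) b) (pt a (b + d))"
    and "dist (pt a b) (pt (a + d) b) = \<bar>d\<bar> * side"
proof -
  have e: "pt a b - pt (a + d) b = - d *\<^sub>R (B - A)" "pt a b - pt a (b + d) = - d *\<^sub>R (C - A)"
       "pt (a + d) b - pt a (b + d) = d *\<^sub>R (B - C)"
    by (simp_all add: pt_def algebra_simps)
  have n: "norm (B - A) = side" "norm (C - A) = side" "norm (B - C) = side"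
    using dist_vertices by (auto simp: dist_norm norm_minus_commute)
  show d: "dist (pt a b) (pt (a + d) b) = \<bar>d\<bar> * side"
    unfolding dist_norm e by (simp add: n)
  have "dist (pt a b) (pt a (b + d)) = \<bar>d\<bar> * side" "dist (pt (a + d) b) (pt a (b + d)) = \<bar>d\<bar> * side"
    unfolding dist_norm e by (simp_all add: n)
  thus "equilateral (pt a b) (pt (a + d) b) (pt a (b + d))"
    using d assms by (simp add: equilateral_def dist_commute)
qed

lemma altitude_copy:
  assumes "d \<noteq> 0"
  shows "altitude (pt a b) (pt (a + d) b) (pt a (b + d)) = \<bar>d\<bar> * height"
proof -
  interpret T: equilateral_triangle "pt a b" "pt (a + d) b" "pt a (b + d)"
    by unfold_locales (rule equilateral_copy[OF assms])
  show ?thesis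
    using T.altitude_eq unfolding T.height_def T.side_def equilateral_copy(2)[OF assms]
    by (simp add: height_def)
qed

lemma area_copy:
  assumes "d \<noteq> 0"
  shows "area (copy a b d) = d\<^sup>2 * area (convex hull {A, B, C})"
proof -
  interpret T: equilateral_triangle "pt a b" "pt (a + d) b" "pt a (b + d)"
    by unfold_locales (rule equilateral_copy[OF assms])
  show ?thesis
    using T.area_eq unfolding T.side_def equilateral_copy(2)[OF assms] area_eq
    by (simp add: copy_def power_mult_distrib)
qed

lemma is_triangle_copy:
  assumes "d \<noteq> 0"
  shows "is_triangle (copy a b d)"
proof -
  interpret T: equilateral_triangle "pt a b" "pt (a + d) b" "pt a (b + d)"
    by unfold_locales (rule equilateral_copy[OF assms])
  show ?thesis
    unfolding is_triangle_def copy_def using T.not_collinear by blast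
qed

text \<open>
  Two homothetic copies of equal size are related by a homothety of ratio \<open>1\<close> or \<open>- 1\<close>, that is, by
  a translation or a point reflection.
\<close>

lemma congruent_copies:
  assumes "\<bar>d\<bar> = \<bar>d'\<bar>" "d \<noteq> 0"
  shows "congruent_figures (copy a b d) (copy a' b' d')"
proof -
  define \<epsilon> where "\<epsilon> = d' / d"
  define f where "f = (\<lambda>x. (pt a' b' - \<epsilon> *\<^sub>R pt a b) + \<epsilon> *\<^sub>R x)"
  have \<epsilon>: "\<bar>\<epsilon>\<bar> = 1" "\<epsilon> * d = d'"
    using assms by (auto simp: \<epsilon>_def abs_if split: if_splits)
  have f_pt: "f (pt (a + x) (b + y)) = pt (a' + \<epsilon> * x) (b' + \<epsilon> * y)" for x y
    by (simp add: f_def pt_def algebra_simps)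
  have "f ` {pt a b, pt (a + d) b, pt a (b + d)} = {pt a' b', pt (a' + d') b', pt a' (b' + d')}"
    using f_pt[of 0 0] f_pt[of d 0] f_pt[of 0 d] by (simp add: \<epsilon>)
  hence "f ` copy a b d = copy a' b' d'"
    unfolding copy_def f_def by (metis convex_hull_affinity)
  moreover have "dist (f x) (f y) = dist x y" for x y
    by (simp add: f_def dist_norm \<epsilon> flip: scaleR_diff_right)
  ultimately show ?thesis
    unfolding congruent_figures_def by blast
qed

lemma dist_level: "dist (pt r 0) (pt 0 r) = \<bar>r\<bar> * side"
proof -
  have "pt r 0 - pt 0 r = r *\<^sub>R (B - C)"
    by (simp add: pt_def algebra_simps)
  moreover have "norm (B - C) = side"
    using dist_vertices by (simp add: dist_norm)
  ultimately show ?thesis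
    by (simp add: dist_norm)
qed

lemma triangle_eq_strip: "convex hull {A, B, C} = strip 0 1"
  using copy_strip[of 1] by (simp add: copy_def)

lemma disjoint_interiors_strips:
  assumes "hi \<le> lo'"
  shows "disjoint_interiors (strip lo hi) (strip lo' hi')"
  using assms by (intro disjoint_interiors_by_line[of 1 1 _ hi]) (auto simp: strip_def)

lemma disjoint_interiors_commute: "disjoint_interiors X Y \<longleftrightarrow> disjoint_interiors Y X"
  by (auto simp: disjoint_interiors_def)

text \<open>
  The line at level \<open>s\<close> cuts the whole triangle into the trapezoid and the copy of ratio \<open>s\<close> at \<open>A\<close>.
\<close>

lemma area_trapezoid:
  assumes "0 < s" "s < 1"
  shows "area (strip s 1) = (1 - s\<^sup>2) * area (convex hull {A, B, C})"
proof -
  have "pt 0 0 \<in> strip 0 s" "pt 0 0 \<notin> strip s 1"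
    using assms unfolding strip_def mem_Collect_eq pt_eq_iff by auto
  hence "strip s 1 \<noteq> strip 0 s" by blast
  moreover have "compact (strip s 1)"
    by (subst convex_hull_trapezoid[OF assms, symmetric]) (auto intro!: finite_imp_compact_convex_hull)
  moreover have "compact (strip 0 s)"
    by (subst copy_strip[OF assms(1), symmetric]) (rule compact_copy)
  ultimately have sum: "area (\<Union>{strip s 1, strip 0 s}) = area (strip s 1) + area (strip 0 s)"
    using disjoint_interiors_strips[of s s 0 1] disjoint_interiors_commute
    by (subst area_Union) (auto simp: convex_strip pairwise_insert)
  have union: "\<Union>{strip s 1, strip 0 s} = convex hull {A, B, C}"
    using assms by (fastforce simp: triangle_eq_strip strip_def)
  have "area (strip 0 s) = s\<^sup>2 * area (convex hull {A, B, C})"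
    using assms area_copy[of s 0 0] copy_strip[of s] by simp
  thus ?thesis
    using sum unfolding union by (simp add: algebra_simps)
qed

lemma area_by_altitude:
  assumes "equilateral a b c" "altitude a b c = h * height"
  shows "area (convex hull {a, b, c}) = h\<^sup>2 * area (convex hull {A, B, C})"
proof -
  interpret T: equilateral_triangle a b c
    by unfold_locales fact
  have "T.side = h * side"
    using T.altitude_eq assms(2) by (simp add: T.height_def height_def)
  thus ?thesis
    by (simp add: T.area_eq area_eq power_mult_distrib)
qed

text \<open>
  A copy has nonempty interior. Hence tiles with disjoint interiors are different sets, which is
  how the tiles are counted.
\<close>

lemma disjoint_interiors_copy_self:
  assumes "d \<noteq> 0"
  shows "\<not> disjoint_interiors (copy a b d) (copy a b d)"
proof
  assume "disjoint_interiors (copy a b d) (copy a b d)"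
  hence "negligible (copy a b d)"
    using convex_copy by (simp add: disjoint_interiors_def negligible_convex_interior)
  hence "area (copy a b d) = 0"
    by (rule negligible_imp_measure0)
  thus False
    using assms side_pos by (simp add: area_copy area_eq)
qed

section \<open>The parameters are determined by areas\<close>

text \<open>
  The endpoints of the first segment above the base lie on the two sides, at coordinates \<open>u\<close> and \<open>v\<close>;
  being parallel to \<open>BC\<close> forces \<open>u = v\<close>, and the length condition of \<open>P2\<close> identifies this number
  with \<open>s\<close>.
\<close>

lemma first_level:
  assumes "configuration A B C L" "P2 L s"
  shows "left_end L 0 = pt 1 0" "right_end L 0 = pt 0 1"
    and "left_end L 1 = pt s 0" "right_end L 1 = pt 0 s"
proof -
  show ends: "left_end L 0 = pt 1 0" "right_end L 0 = pt 0 1"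
    using assms(1) by (simp_all add: configuration_def)
  have "left_end L 1 \<in> closed_segment (pt 0 0) (pt 1 0)"
    using assms(1) by (simp add: configuration_def)
  then obtain u where u: "0 \<le> u" "left_end L 1 = pt u 0"
    unfolding in_segment by (auto simp: pt_convex_comb simp del: pt_vertices)
  have "right_end L 1 \<in> closed_segment (pt 0 0) (pt 0 1)"
    using assms(1) by (simp add: configuration_def)
  then obtain v where v: "right_end L 1 = pt 0 v"
    unfolding in_segment by (auto simp: pt_convex_comb simp del: pt_vertices)
  obtain c where "right_end L 1 - left_end L 1 = c *\<^sub>R (C - B)"
    using assms(1) unfolding configuration_def by blast
  hence "pt 0 v = pt u 0 + c *\<^sub>R (C - B)"
    unfolding u(2) v by (simp only: diff_eq_eq add.commute)
  also have "\<dots> = pt (u - c) c"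
    by (simp add: pt_def algebra_simps)
  finally have "v = u"
    by simp
  moreover have "dist (left_end L 1) (right_end L 1) = s * dist (left_end L 0) (right_end L 0)"
    using assms(2) by (simp add: P2_def)
  hence "u = s"
    using u(1) side_pos unfolding ends u(2) v \<open>v = u\<close> dist_level by simp
  ultimately show "left_end L 1 = pt s 0" "right_end L 1 = pt 0 s"
    using u v by simp_all
qed

text \<open>
  The area of the first layer is computed once as the sum of its tiles and once as a trapezoid;
  the second equation is the last clause of \<open>P3\<close> with the tile area inserted.
\<close>

lemma area_count:
  assumes "area (convex hull {A, B, C}) = 1"
    and "configuration A B C L" "P1 A B C L n k" "P2 L s" "P3 L k s"
  shows "real n * (1 - s)\<^sup>2 = 1 - s\<^sup>2" "real k * (1 - s)\<^sup>2 = s\<^sup>2"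
proof -
  note ends = first_level[OF assms(2,4)]
  have s: "0 < s" "s < 1"
    using assms(4) by (auto simp: P2_def)
  have "setdist (seg L 0) (seg L 1) = (1 - s) * height"
    unfolding seg_def ends setdist_segments using s by simp
  hence tile: "\<exists>a b c. t = convex hull {a, b, c} \<and> equilateral a b c \<and> altitude a b c = (1 - s) * height"
    if "t \<in> tiles L 0" for t
    using assms(3) that unfolding P1_def One_nat_def by metis
  have area_tile: "area t = (1 - s)\<^sup>2" if "t \<in> tiles L 0" for t
    using tile[OF that] area_by_altitude assms(1) by auto
  have card: "card (tiles L 0) = n" "1 \<le> k" "k < n"
    using assms(3) by (auto simp: P1_def)
  have tiles: "finite (tiles L 0)" "pairwise disjoint_interiors (tiles L 0)" "\<Union>(tiles L 0) = layer L 0"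
    using assms(2) by (auto simp: configuration_def)
  have "layer L 0 = strip s 1"
    using convex_hull_trapezoid[OF s] ends by (simp add: layer_def)
  hence "(1 - s\<^sup>2) = area (\<Union>(tiles L 0))"
    using area_trapezoid[OF s] assms(1) tiles by simp
  also have "\<dots> = (\<Sum>t\<in>tiles L 0. area t)"
    using tiles tile by (intro area_Union) (auto intro!: finite_imp_compact_convex_hull dest!: tile)
  also have "\<dots> = real n * (1 - s)\<^sup>2"
    using area_tile card by simp
  finally show "real n * (1 - s)\<^sup>2 = 1 - s\<^sup>2" by simp
  obtain t where "t \<in> tiles L 0"
    using card by fastforce
  thus "real k * (1 - s)\<^sup>2 = s\<^sup>2"
    using assms(5) area_tile unfolding P3_def by metis
qed

end

text \<open>
  Eliminating \<open>s\<close> leaves \<open>4 k = (n - 1)\<^sup>2\<close>. This exceeds \<open>4 (n - 1)\<close>, which is at least \<open>4 k\<close>, as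
  soon as \<open>n \<ge> 6\<close>; among the remaining values, \<open>n = 2\<close> and \<open>n = 4\<close> make \<open>(n - 1)\<^sup>2\<close> odd.
\<close>

lemma solve_counts:
  fixes n k :: nat and s :: real
  assumes "real n * (1 - s)\<^sup>2 = 1 - s\<^sup>2" "real k * (1 - s)\<^sup>2 = s\<^sup>2"
    and "0 < s" "s < 1" "k < n"
  shows "(n, k, s) = (3, 1, 1/2) \<or> (n, k, s) = (5, 4, 2/3)"
proof -
  have "(1 - s) * (real n * (1 - s)) = (1 - s) * (1 + s)"
    using assms(1) by (simp add: power2_eq_square algebra_simps)
  hence n: "real n * (1 - s) = 1 + s"
    using assms(4) by simp
  hence n1: "(real n - 1) * (1 - s) = 2 * s"
    by (simp add: algebra_simps)
  have "(real n - 1)\<^sup>2 * (1 - s)\<^sup>2 = 4 * real k * (1 - s)\<^sup>2"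
    using assms(2) unfolding power_mult_distrib[symmetric] n1 by simp
  hence k: "(real n - 1)\<^sup>2 = 4 * real k"
    using assms(4) by simp
  have "n < 6"
  proof (rule ccontr)
    assume "\<not> n < 6"
    hence "6 * real n \<le> real n * real n" by (intro mult_right_mono) auto
    moreover have "real k + 1 \<le> real n" using assms(5) by simp
    ultimately show False
      using k unfolding power2_eq_square ring_distribs by linarith
  qed
  moreover have "n \<noteq> 0" "n \<noteq> 1"
    using n assms(3) by (auto intro!: Nat.gr0I)
  moreover have "n \<noteq> 2"
  proof
    assume "n = 2"
    hence "real 1 = real (4 * k)" using k by simp
    hence "1 = 4 * k" by (simp only: of_nat_eq_iff)
    thus False by presburger
  qed
  moreover have "n \<noteq> 4"
  proof
    assume "n = 4"
    hence "real 9 = real (4 * k)" using k by simp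
    hence "9 = 4 * k" by (simp only: of_nat_eq_iff)
    thus False by presburger
  qed
  ultimately consider "n = 3" | "n = 5" by linarith
  thus ?thesis
  proof cases
    case 1
    thus ?thesis using n k by simp
  next
    case 2
    thus ?thesis using n k by simp
  qed
qed

section \<open>The triangular grid in every layer\<close>

text \<open>
  \<open>S\<close> and \<open>T\<close> are the indices of the shaded up and down tiles, the same in all layers. Giving the
  shading by indices rather than by sets of tiles lets the number of shaded tiles follow from the
  geometry.
\<close>

locale grid = equilateral_triangle +
  fixes m :: nat and S T :: "nat set" and k :: nat and L :: layering and s :: real
  defines "s \<equiv> real (m - 1) / real m"
  assumes m: "m \<ge> 2"
    and left: "left_end L = side_point A B s"
    and right: "right_end L = side_point A C s"
    and tiles: "\<And>j. tiles L j =
      up_tile m (left_end L j) (right_end L j) (left_end L (Suc j)) (right_end L (Suc j)) ` {..<m} \<union>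
      down_tile m (left_end L j) (right_end L j) (left_end L (Suc j)) (right_end L (Suc j)) ` {..<m-1}"
    and shaded: "\<And>j. shaded L j =
      up_tile m (left_end L j) (right_end L j) (left_end L (Suc j)) (right_end L (Suc j)) ` S \<union>
      down_tile m (left_end L j) (right_end L j) (left_end L (Suc j)) (right_end L (Suc j)) ` T"
    and S: "S \<subseteq> {..<m}" and T: "T \<subseteq> {..<m-1}"
    and k: "k = card S + card T" "1 \<le> k" "k < 2 * m - 1"
begin

definition mesh :: "nat \<Rightarrow> real" where "mesh j = s ^ j / real m"

definition up :: "nat \<Rightarrow> nat \<Rightarrow> (real^2) set" where
  "up j i = copy ((real m - 1 - real i) * mesh j) (real i * mesh j) (mesh j)"

definition down :: "nat \<Rightarrow> nat \<Rightarrow> (real^2) set" where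
  "down j i = copy ((real m - 1 - real i) * mesh j) ((real i + 1) * mesh j) (- mesh j)"

lemma s_bounds: "0 < s" "s < 1"
  using m by (simp_all add: s_def)

lemma mesh_pos: "mesh j > 0"
  using s_bounds m by (simp add: mesh_def)

lemma index_mesh_nonneg: "0 \<le> real i * mesh j"
  using mesh_pos[of j] by simp

text \<open>
  Both bounding segments of a layer sit at multiples of the mesh, because \<open>s = (m - 1) / m\<close>. So the
  \<open>m\<close> parts of the lower segment and the \<open>m - 1\<close> parts of the upper one have the same length.
\<close>

lemma level_eq: "s ^ j = real m * mesh j" "s ^ Suc j = (real m - 1) * mesh j"
  using m by (simp_all add: mesh_def s_def of_nat_diff)

lemma ends: "left_end L j = pt (s ^ j) 0" "right_end L j = pt 0 (s ^ j)"
  by (simp_all add: left right side_point_def pt_def)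

lemma seg_eq: "seg L j = closed_segment (pt (s ^ j) 0) (pt 0 (s ^ j))"
  by (simp add: seg_def ends)

lemma layer_eq: "layer L j = strip (s ^ Suc j) (s ^ j)"
proof -
  have "s ^ Suc j < s ^ j"
    using s_bounds by simp
  thus ?thesis
    using convex_hull_trapezoid[of "s ^ Suc j" "s ^ j"] s_bounds
    unfolding layer_def ends by simp
qed

lemma div_points:
  "div_point m (left_end L j) (right_end L j) i = pt ((real m - real i) * mesh j) (real i * mesh j)"
  "div_point (m - 1) (left_end L (Suc j)) (right_end L (Suc j)) i =
     pt ((real m - 1 - real i) * mesh j) (real i * mesh j)"
proof -
  have pt: "pt x 0 + t *\<^sub>R (pt 0 x - pt x 0) = pt (x - t * x) (t * x)" for x t
    by (simp add: pt_def algebra_simps)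
  show "div_point m (left_end L j) (right_end L j) i = pt ((real m - real i) * mesh j) (real i * mesh j)"
    unfolding div_point_def ends level_eq[of j] pt pt_eq_iff using m by (simp add: field_simps)
  have "real (m - 1) = real m - 1" "real m - 1 \<noteq> 0"
    using m by (simp_all add: of_nat_diff)
  thus "div_point (m - 1) (left_end L (Suc j)) (right_end L (Suc j)) i =
     pt ((real m - 1 - real i) * mesh j) (real i * mesh j)"
    unfolding div_point_def ends level_eq[of j] pt pt_eq_iff by (simp add: field_simps)
qed

lemma tiles_eq: "tiles L j = up j ` {..<m} \<union> down j ` {..<m - 1}"
  and shaded_eq: "shaded L j = up j ` S \<union> down j ` T"
proof -
  have "up_tile m (left_end L j) (right_end L j) (left_end L (Suc j)) (right_end L (Suc j)) i = up j i"
    for i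
    unfolding up_tile_def div_points up_def copy_def by (simp add: algebra_simps insert_commute)
  moreover have "down_tile m (left_end L j) (right_end L j) (left_end L (Suc j)) (right_end L (Suc j)) i
      = down j i" for i
    unfolding down_tile_def div_points down_def copy_def by (simp add: algebra_simps insert_commute)
  ultimately show "tiles L j = up j ` {..<m} \<union> down j ` {..<m - 1}" "shaded L j = up j ` S \<union> down j ` T"
    by (simp_all add: tiles shaded)
qed

lemma shaded_subset: "shaded L j \<subseteq> tiles L j"
  unfolding tiles_eq shaded_eq using S T by blast

lemma in_tiles:
  assumes "t \<in> tiles L j"
  obtains a b e where "t = copy a b e" "\<bar>e\<bar> = mesh j"
proof -
  have "\<bar>mesh j\<bar> = mesh j" "\<bar>- mesh j\<bar> = mesh j"
    using mesh_pos[of j] by simp_all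
  thus ?thesis
    using assms that unfolding tiles_eq up_def down_def by blast
qed

lemma up_region:
  "up j i = {pt \<alpha> \<beta> |\<alpha> \<beta>. (real m - 1 - real i) * mesh j \<le> \<alpha> \<and> real i * mesh j \<le> \<beta> \<and> \<alpha> + \<beta> \<le> real m * mesh j}"
  unfolding up_def copy_upward[OF mesh_pos] by (simp add: algebra_simps)

lemma down_region:
  "down j i = {pt \<alpha> \<beta> |\<alpha> \<beta>. \<alpha> \<le> (real m - 1 - real i) * mesh j \<and> \<beta> \<le> (real i + 1) * mesh j \<and>
     (real m - 1) * mesh j \<le> \<alpha> + \<beta>}"
  unfolding down_def copy_downward[OF mesh_pos] by (simp add: algebra_simps)

lemma less_imp_mesh:
  assumes "i < i'"
  shows "real i * mesh j + mesh j \<le> real i' * mesh j"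
proof -
  have "(real i + 1) * mesh j \<le> real i' * mesh j"
    using assms mesh_pos[of j] by (intro mult_right_mono) auto
  thus ?thesis by (simp add: algebra_simps)
qed

text \<open>
  For the covering, the index \<open>i\<close> of a point is its second coordinate rounded down to a multiple of
  the mesh; its first coordinate then decides between the up tile and the down tile with this index.
\<close>

lemma Union_tiles: "\<Union>(tiles L j) = layer L j"
proof
  have "up j i \<subseteq> layer L j" if "i < m" for i
  proof
    fix x assume "x \<in> up j i"
    then obtain \<alpha> \<beta> where "x = pt \<alpha> \<beta>" "(real m - 1 - real i) * mesh j \<le> \<alpha>" "real i * mesh j \<le> \<beta>"
        "\<alpha> + \<beta> \<le> real m * mesh j"
      unfolding up_region by blast
    moreover from this have "0 \<le> \<beta>"
      using index_mesh_nonneg[of i j] by linarith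
    ultimately show "x \<in> layer L j"
      using less_imp_mesh[OF that, of j] mesh_pos[of j]
      unfolding layer_eq level_eq[of j] strip_def by (auto simp: algebra_simps)
  qed
  moreover have "down j i \<subseteq> layer L j" if "i < m - 1" for i
  proof
    fix x assume "x \<in> down j i"
    then obtain \<alpha> \<beta> where "x = pt \<alpha> \<beta>" "\<alpha> \<le> (real m - 1 - real i) * mesh j" "\<beta> \<le> (real i + 1) * mesh j"
        "(real m - 1) * mesh j \<le> \<alpha> + \<beta>"
      unfolding down_region by blast
    moreover have "(real m - 1) * mesh j - (real m - 1 - real i) * mesh j \<le> \<beta>"
      using calculation by linarith
    hence "real i * mesh j \<le> \<beta>"
      by (simp add: algebra_simps)
    hence "0 \<le> \<beta>"
      using index_mesh_nonneg[of i j] by linarith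
    moreover have "real (Suc i) * mesh j + mesh j \<le> real m * mesh j"
      using that by (intro less_imp_mesh) auto
    ultimately show "x \<in> layer L j"
      using mesh_pos[of j]
      unfolding layer_eq level_eq[of j] strip_def by (auto simp: algebra_simps)
  qed
  ultimately show "\<Union>(tiles L j) \<subseteq> layer L j"
    by (auto simp: tiles_eq)
  show "layer L j \<subseteq> \<Union>(tiles L j)"
  proof
    fix x assume "x \<in> layer L j"
    then obtain \<alpha> \<beta> where x: "x = pt \<alpha> \<beta>" "0 \<le> \<alpha>" "0 \<le> \<beta>" "(real m - 1) * mesh j \<le> \<alpha> + \<beta>"
        "\<alpha> + \<beta> \<le> real m * mesh j"
      unfolding layer_eq level_eq[of j] strip_def by blast
    \<comment> \<open>The minimum matters only at the corner \<open>\<beta> = m * mesh j\<close>, which belongs to the last up tile.\<close>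
    define i where "i = min (m - 1) (nat \<lfloor>\<beta> / mesh j\<rfloor>)"
    have i_less: "i < m"
      using m by (simp add: i_def)
    have "real (nat \<lfloor>\<beta> / mesh j\<rfloor>) \<le> \<beta> / mesh j"
      using x mesh_pos[of j] by (intro of_nat_floor) simp
    hence "real i \<le> \<beta> / mesh j"
      by (simp add: i_def min_def)
    hence i_le: "real i * mesh j \<le> \<beta>"
      using mesh_pos[of j] by (simp add: field_simps)
    show "x \<in> \<Union>(tiles L j)"
    proof (cases "(real m - 1 - real i) * mesh j \<le> \<alpha>")
      case True
      hence "x \<in> up j i"
        using x i_le unfolding up_region by blast
      thus ?thesis
        using i_less by (auto simp: tiles_eq)
    next
      case False
      hence "i \<noteq> m - 1"
        using x m by (auto simp: of_nat_diff)
      hence i: "i < m - 1" "i = nat \<lfloor>\<beta> / mesh j\<rfloor>"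
        using i_less by (auto simp: i_def min_def split: if_splits)
      have "\<beta> / mesh j \<le> real i + 1"
        using x mesh_pos[of j] unfolding i(2) by linarith
      hence "\<beta> \<le> (real i + 1) * mesh j"
        using mesh_pos[of j] by (simp add: field_simps)
      hence "x \<in> down j i"
        using x False unfolding down_region by force
      thus ?thesis
        using i by (auto simp: tiles_eq)
    qed
  qed
qed

text \<open>
  Any two tiles of a layer are separated by a lattice line parallel to one of the sides \<open>AB\<close>, \<open>AC\<close>.
\<close>

lemma disjoint_up_up:
  assumes "i < i'"
  shows "disjoint_interiors (up j i) (up j i')"
  using less_imp_mesh[OF assms, of j] unfolding up_region
  by (intro disjoint_interiors_by_line[of "-1" 0 _ "- ((real m - 1 - real i) * mesh j)"])
    (force simp: algebra_simps)+

lemma disjoint_down_down: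
  assumes "i < i'"
  shows "disjoint_interiors (down j i) (down j i')"
  using less_imp_mesh[OF assms, of j] unfolding down_region
  by (intro disjoint_interiors_by_line[of 0 1 _ "(real i + 1) * mesh j"])
    (force simp: algebra_simps)+

lemma disjoint_up_down: "disjoint_interiors (up j i) (down j i')"
proof (cases "i' < i")
  case True
  show ?thesis
    using less_imp_mesh[OF True, of j] unfolding up_region down_region
    by (intro disjoint_interiors_by_line[of 0 "-1" _ "- (real i * mesh j)"])
      (force simp: algebra_simps)+
next
  case False
  hence "real i * mesh j \<le> real i' * mesh j"
    using mesh_pos[of j] by simp
  thus ?thesis
    unfolding up_region down_region
    by (intro disjoint_interiors_by_line[of "-1" 0 _ "- ((real m - 1 - real i) * mesh j)"])
      (force simp: algebra_simps)+
qed

lemma pairwise_tiles: "pairwise disjoint_interiors (tiles L j)"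
  unfolding tiles_eq pairwise_def
proof (intro ballI impI)
  have same: "disjoint_interiors (up j i) (up j i')" "disjoint_interiors (down j i) (down j i')"
    if "i \<noteq> i'" for i i'
    using that disjoint_up_up disjoint_down_down disjoint_interiors_commute
    by (metis linorder_neqE_nat)+
  have mixed: "disjoint_interiors (down j i) (up j i')" for i i'
    by (subst disjoint_interiors_commute) (rule disjoint_up_down)
  fix t t' assume "t \<noteq> t'" "t \<in> up j ` {..<m} \<union> down j ` {..<m - 1}"
    "t' \<in> up j ` {..<m} \<union> down j ` {..<m - 1}"
  thus "disjoint_interiors t t'"
    by (elim UnE imageE) (auto intro!: same mixed disjoint_up_down)
qed

lemma card_up_down:
  assumes "finite I" "finite J"
  shows "card (up j ` I \<union> down j ` J) = card I + card J"
proof -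
  have self: "\<not> disjoint_interiors (up j i) (up j i)" "\<not> disjoint_interiors (down j i) (down j i)" for i
    using mesh_pos[of j] unfolding up_def down_def by (auto simp: disjoint_interiors_copy_self)
  have "inj (up j)" "inj (down j)"
    using self disjoint_up_up disjoint_down_down by (metis linorder_injI)+
  hence "card (up j ` I) = card I" "card (down j ` J) = card J"
    by (auto intro!: card_image elim: inj_on_subset)
  moreover have "up j i \<noteq> down j i'" for i i'
    using self(1)[of i] disjoint_up_down[of j i i'] by auto
  hence "up j ` I \<inter> down j ` J = {}"
    by blast
  ultimately show ?thesis
    using assms by (subst card_Un_disjoint) auto
qed

lemma card_tiles: "card (tiles L j) = 2 * m - 1"
  unfolding tiles_eq using m by (simp add: card_up_down)

lemma card_shaded: "card (shaded L j) = k"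
  unfolding shaded_eq k(1) using S T finite_subset by (intro card_up_down) blast+

lemma setdist_seg: "setdist (seg L j) (seg L (Suc j)) = mesh j * height"
  unfolding seg_eq setdist_segments level_eq[of j] using mesh_pos[of j]
  by (simp add: algebra_simps)

lemma is_configuration: "configuration A B C L"
proof -
  have "left_end L j \<in> closed_segment A B" "right_end L j \<in> closed_segment A C" for j
    unfolding left right side_point_def in_segment
    using s_bounds by (auto intro!: exI[of _ "s ^ j"] power_le_one simp: algebra_simps)
  moreover have "right_end L j - left_end L j = s ^ j *\<^sub>R (C - B)" "s ^ j \<noteq> 0" for j
    using s_bounds by (simp_all add: left right side_point_def algebra_simps)
  moreover have "infdist A (seg L (Suc j)) < infdist A (seg L j)" for j
  proof -
    have "infdist A (seg L i) = s ^ i * height" for i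
      using setdist_segments[of 0 "s ^ i"] s_bounds by (simp add: infdist_eq_setdist seg_eq)
    thus ?thesis
      using s_bounds height_pos by simp
  qed
  moreover have "is_triangle t" if "t \<in> tiles L j" for t j
    using that mesh_pos[of j] by (elim in_tiles) (auto intro!: is_triangle_copy)
  moreover have "finite (tiles L j)" for j
    by (simp add: tiles_eq)
  moreover have "left_end L 0 = B" "right_end L 0 = C"
    by (simp_all add: ends)
  ultimately show ?thesis
    unfolding configuration_def using pairwise_tiles Union_tiles shaded_subset by blast
qed

text \<open>
  A point other than \<open>A\<close> has a positive level \<open>\<alpha> + \<beta>\<close>, and the powers of \<open>s\<close> tend to \<open>0\<close>. So some
  power falls to that level or below it, and the first positive exponent that does so gives the
  layer.
\<close>

lemma Union_layers: "(\<Union>j. layer L j) = convex hull {A, B, C} - {A}"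
proof (intro equalityI subsetI)
  fix x assume "x \<in> (\<Union>j. layer L j)"
  then obtain j \<alpha> \<beta> where x: "x = pt \<alpha> \<beta>" "0 \<le> \<alpha>" "0 \<le> \<beta>" "s ^ Suc j \<le> \<alpha> + \<beta>" "\<alpha> + \<beta> \<le> s ^ j"
    unfolding layer_eq strip_def by blast
  have "0 < s ^ Suc j" "s ^ j \<le> 1"
    using s_bounds by (simp_all add: power_le_one)
  hence "0 < \<alpha> + \<beta>" "\<alpha> + \<beta> \<le> 1"
    using x by linarith+
  hence "x \<in> strip 0 1" "x \<noteq> pt 0 0"
    using x(2,3) unfolding x(1) strip_def mem_Collect_eq pt_eq_iff by auto
  thus "x \<in> convex hull {A, B, C} - {A}"
    by (simp add: triangle_eq_strip)
next
  fix x assume "x \<in> convex hull {A, B, C} - {A}"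
  hence "x \<in> strip 0 1" "x \<noteq> pt 0 0"
    by (simp_all add: triangle_eq_strip)
  then obtain \<alpha> \<beta> where x: "x = pt \<alpha> \<beta>" "0 \<le> \<alpha>" "0 \<le> \<beta>" "\<alpha> + \<beta> \<le> 1"
    unfolding strip_def by blast
  have "\<alpha> \<noteq> 0 \<or> \<beta> \<noteq> 0"
    using \<open>x \<noteq> pt 0 0\<close> unfolding x(1) pt_eq_iff by blast
  hence pos: "0 < \<alpha> + \<beta>"
    using x by linarith
  define j where "j = (LEAST j. s ^ Suc j \<le> \<alpha> + \<beta>)"
  obtain i where "s ^ i < \<alpha> + \<beta>"
    using pos s_bounds real_arch_pow_inv by blast
  moreover have "s ^ Suc i \<le> s ^ i"
    using s_bounds by simp
  ultimately have "s ^ Suc i \<le> \<alpha> + \<beta>" by linarith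
  hence lower: "s ^ Suc j \<le> \<alpha> + \<beta>"
    unfolding j_def by (rule LeastI)
  have "\<alpha> + \<beta> \<le> s ^ j"
  proof (cases j)
    case 0
    thus ?thesis using x by simp
  next
    case (Suc i)
    hence "\<not> s ^ Suc i \<le> \<alpha> + \<beta>"
      unfolding j_def by (intro not_less_Least) simp
    thus ?thesis using Suc by simp
  qed
  thus "x \<in> (\<Union>j. layer L j)"
    using x lower unfolding layer_eq strip_def by blast
qed

lemma satisfies_P1: "P1 A B C L (2 * m - 1) k"
proof -
  have layers: "disjoint_interiors (layer L i) (layer L j)" if "i \<noteq> j" for i j
  proof -
    have "disjoint_interiors (layer L j) (layer L i)" if "i < j" for i j
      unfolding layer_eq using that s_bounds
      by (intro disjoint_interiors_strips power_decreasing) auto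
    thus ?thesis
      using \<open>i \<noteq> j\<close> disjoint_interiors_commute by (metis linorder_neqE_nat)
  qed
  have congruent: "congruent_figures t t'" if "t \<in> tiles L j" "t' \<in> tiles L j" for t t' j
    using that mesh_pos[of j] by (elim in_tiles) (auto intro!: congruent_copies)
  have equilateral: "\<exists>a b c. t = convex hull {a, b, c} \<and> equilateral a b c \<and>
      altitude a b c = setdist (seg L j) (seg L (Suc j))" if "t \<in> tiles L j" for t j
  proof -
    obtain a b e where t: "t = copy a b e" "\<bar>e\<bar> = mesh j"
      by (rule in_tiles[OF \<open>t \<in> tiles L j\<close>])
    hence "e \<noteq> 0"
      using mesh_pos[of j] by auto
    thus ?thesis
      using equilateral_copy(1) altitude_copy t setdist_seg unfolding copy_def by metis
  qed
  show ?thesis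
    unfolding P1_def
    by (intro conjI allI impI ballI)
      (assumption | rule Union_layers layers k card_tiles card_shaded congruent equilateral)+
qed

lemma satisfies_P2: "P2 L s"
  unfolding P2_def ends dist_level using s_bounds by simp

text \<open>
  Each tile of layer \<open>j\<close> has area \<open>(s\<^sup>j / m)\<^sup>2\<close>. Thus \<open>u = 1 / m\<^sup>2\<close>, and \<open>k u\<close> equals \<open>s\<^sup>2\<close> because
  \<open>s = (m - 1) / m\<close>.
\<close>

lemma satisfies_P3:
  assumes "area (convex hull {A, B, C}) = 1" "k = (m - 1)\<^sup>2"
  shows "P3 L k s"
  unfolding P3_def
proof (intro exI conjI allI ballI)
  have area_tile: "area t = (mesh j)\<^sup>2" if "t \<in> tiles L j" for t j
  proof -
    obtain a b e where t: "t = copy a b e" "\<bar>e\<bar> = mesh j"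
      by (rule in_tiles[OF \<open>t \<in> tiles L j\<close>])
    hence "e \<noteq> 0" "e\<^sup>2 = (mesh j)\<^sup>2"
      using mesh_pos[of j] by (auto simp flip: t(2))
    thus ?thesis
      using assms by (simp add: t area_copy)
  qed
  show "area t = 1 / (real m)\<^sup>2" if "t \<in> tiles L 0" for t
    using area_tile[OF that] by (simp add: mesh_def power_divide)
  show "shaded_area L j = real k * (1 / (real m)\<^sup>2) * (s\<^sup>2) ^ j" for j
  proof -
    have "finite (shaded L j)"
      using shaded_subset[of j] finite_subset by (fastforce simp: tiles_eq)
    moreover have "compact t \<and> convex t" if "t \<in> shaded L j" for t
      using that shaded_subset in_tiles compact_copy convex_copy by (metis subsetD)
    moreover have "pairwise disjoint_interiors (shaded L j)"
      using pairwise_tiles shaded_subset by (rule pairwise_subset)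
    ultimately have "shaded_area L j = (\<Sum>t\<in>shaded L j. area t)"
      unfolding shaded_area_def by (intro area_Union)
    also have "\<dots> = (\<Sum>t\<in>shaded L j. (mesh j)\<^sup>2)"
      using shaded_subset area_tile by (intro sum.cong) blast+
    also have "\<dots> = real k * (1 / (real m)\<^sup>2) * (s\<^sup>2) ^ j"
      using card_shaded by (simp add: mesh_def power_divide power_even_eq flip: power_mult)
    finally show ?thesis .
  qed
  show "real k * (1 / (real m)\<^sup>2) = s\<^sup>2"
    by (simp add: assms(2) s_def power_divide)
qed

end

section \<open>The two configurations\<close>

theorem theorem2p2:
  fixes A B C :: "real^2"
  assumes "equilateral A B C"
    and "area (convex hull {A, B, C}) = 1"
  shows "(\<forall>L n k s. configuration A B C L \<and> P1 A B C L n k \<and> P2 L s \<and> P3 L k s \<longrightarrow>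
            (n, k, s) = (3, 1, 1/2) \<or> (n, k, s) = (5, 4, 2/3)) \<and>
         (configuration A B C (mabry A B C) \<and> P1 A B C (mabry A B C) 3 1 \<and>
          P2 (mabry A B C) (1/2) \<and> P3 (mabry A B C) 1 (1/2)) \<and>
         (configuration A B C (edgar A B C) \<and> P1 A B C (edgar A B C) 5 4 \<and>
          P2 (edgar A B C) (2/3) \<and> P3 (edgar A B C) 4 (2/3))"
proof -
  interpret equilateral_triangle A B C
    by unfold_locales fact
  have "(n, k, s) = (3, 1, 1/2) \<or> (n, k, s) = (5, 4, 2/3)"
    if "configuration A B C L" "P1 A B C L n k" "P2 L s" "P3 L k s" for L n k s
  proof (rule solve_counts)
    show "real n * (1 - s)\<^sup>2 = 1 - s\<^sup>2" "real k * (1 - s)\<^sup>2 = s\<^sup>2"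
      using area_count[OF assms(2) that] by auto
    show "0 < s" "s < 1" "k < n"
      using that by (auto simp: P1_def P2_def)
  qed
  moreover
  have range: "{..<2} = {0, 1 :: nat}" "{..<3} = {0, 1, 2 :: nat}" "{..<1} = {0 :: nat}"
    by auto
  interpret M: grid A B C 2 "{}" "{0}" 1 "mabry A B C" "1 / 2"
    by unfold_locales (auto simp: mabry_def Let_def range)
  have "configuration A B C (mabry A B C) \<and> P1 A B C (mabry A B C) 3 1 \<and>
      P2 (mabry A B C) (1/2) \<and> P3 (mabry A B C) 1 (1/2)"
    using M.is_configuration M.satisfies_P1 M.satisfies_P2 M.satisfies_P3[OF assms(2)] by simp
  moreover
  interpret E: grid A B C 3 "{0, 2}" "{0, 1}" 4 "edgar A B C" "2 / 3"
    by unfold_locales (auto simp: edgar_def Let_def range)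
  have "configuration A B C (edgar A B C) \<and> P1 A B C (edgar A B C) 5 4 \<and>
      P2 (edgar A B C) (2/3) \<and> P3 (edgar A B C) 4 (2/3)"
    using E.is_configuration E.satisfies_P1 E.satisfies_P2 E.satisfies_P3[OF assms(2)] by simp
  ultimately show ?thesis by blast
qed

end
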